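(* Assume that $(u_0,\rho_0)$ is subsonic, i.e. $u_0^2<\gamma\rho_0^{\gamma-1}$, and that the external force $\bar f\in C^\infty([L_0,L_1])$ satisfies $$\bar f<0\ \text{on } [L_0,0),\qquad \bar f(0)=0,\qquad \bar f>0\ \text{on } (0,L_1],$$ and $$\int_{L_0}^{0}\bar f(\tau)\,d\tau=\frac{\gamma+1}{2(\gamma-1)}\gamma^{\frac{2}{\gamma+1}}J^{\frac{2(\gamma-1)}{\gamma+1}}-B_0 .$$ Then there exists a unique accelerating transonic flow $(\bar u(x_1),\bar\rho(x_1))\in C([L_0,L_1])$ which is subsonic in $[L_0,0)$, supersonic in $(0,L_1]$, with a sonic state at $x_1=0$. Furthermore, $(\bar u,\bar\rho)$ is smooth on $[L_0,0)\cup(0,L_1]$ and satisfies there the equations $$(\bar\rho\bar u)'=0,\qquad \bar\rho\bar u\bar u'+\frac{d}{dx_1}P(\bar\rho)=\bar\rho\bar f,$$ with $\bar\rho(L_0)=\rho_0$, $\bar u(L_0)=u_0$.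
   Context: Here $\gamma>1$, $P(\rho)=\rho^\gamma$, $L_0<0<L_1$, $\rho_0>0$, $u_0>0$, $J=\rho_0u_0$, $B_0=\frac12u_0^2+\frac{\gamma}{\gamma-1}\rho_0^{\gamma-1}$. The sound speed is $c(\rho)=\sqrt{\gamma\rho^{\gamma-1}}$; a state $(u,\rho)$ with $u,\rho>0$ is subsonic, sonic or supersonic if $u^2<c^2(\rho)$, $u^2=c^2(\rho)$ or $u^2>c^2(\rho)$ respectively. A (continuous) flow with the given initial state means a pair of positive continuous functions with $\bar\rho\bar u=J$ and the Bernoulli law $\frac12\bar u(x_1)^2+\frac{\gamma}{\gamma-1}\bar\rho(x_1)^{\gamma-1}-\int_{L_0}^{x_1}\bar f(\tau)\,d\tau=B_0$ for all $x_1\in[L_0,L_1]$, and $(\bar u,\bar\rho)(L_0)=(u_0,\rho_0)$; it is accelerating if $\bar u$ is increasing. *)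

theory Defs
  imports "HOL-Analysis.Analysis"
begin

(* C^infinity relative to S: all iterated derivatives exist, taken within S, hence one-sided
   at endpoints of intervals belonging to S.  Meant for sets S without isolated points. *)
definition smooth_on :: "real set \<Rightarrow> (real \<Rightarrow> real) \<Rightarrow> bool" where
  "smooth_on S g \<longleftrightarrow>
     (\<exists>D :: nat \<Rightarrow> real \<Rightarrow> real. (\<forall>x\<in>S. D 0 x = g x) \<and>
        (\<forall>k. \<forall>x\<in>S. (D k has_real_derivative D (Suc k) x) (at x within S)))"

definition pressure :: "real \<Rightarrow> real \<Rightarrow> real" where
  "pressure \<gamma> \<rho> = \<rho> powr \<gamma>"

definition sound_speed :: "real \<Rightarrow> real \<Rightarrow> real" where
  "sound_speed \<gamma> \<rho> = sqrt (\<gamma> * \<rho> powr (\<gamma> - 1))"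

definition subsonic :: "real \<Rightarrow> real \<Rightarrow> real \<Rightarrow> bool" where
  "subsonic \<gamma> u \<rho> \<longleftrightarrow> u > 0 \<and> \<rho> > 0 \<and> u\<^sup>2 < (sound_speed \<gamma> \<rho>)\<^sup>2"

definition sonic :: "real \<Rightarrow> real \<Rightarrow> real \<Rightarrow> bool" where
  "sonic \<gamma> u \<rho> \<longleftrightarrow> u > 0 \<and> \<rho> > 0 \<and> u\<^sup>2 = (sound_speed \<gamma> \<rho>)\<^sup>2"

definition supersonic :: "real \<Rightarrow> real \<Rightarrow> real \<Rightarrow> bool" where
  "supersonic \<gamma> u \<rho> \<longleftrightarrow> u > 0 \<and> \<rho> > 0 \<and> u\<^sup>2 > (sound_speed \<gamma> \<rho>)\<^sup>2"

definition bernoulli :: "real \<Rightarrow> real \<Rightarrow> real \<Rightarrow> real" where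
  "bernoulli \<gamma> u \<rho> = u\<^sup>2 / 2 + \<gamma> / (\<gamma> - 1) * \<rho> powr (\<gamma> - 1)"

definition flow ::
  "real \<Rightarrow> real \<Rightarrow> real \<Rightarrow> real \<Rightarrow> real \<Rightarrow> (real \<Rightarrow> real) \<Rightarrow> (real \<Rightarrow> real) \<Rightarrow> (real \<Rightarrow> real) \<Rightarrow> bool" where
  "flow \<gamma> L\<^sub>0 L\<^sub>1 u\<^sub>0 \<rho>\<^sub>0 f u \<rho> \<longleftrightarrow>
     continuous_on {L\<^sub>0..L\<^sub>1} u \<and> continuous_on {L\<^sub>0..L\<^sub>1} \<rho> \<and>
     (\<forall>x\<in>{L\<^sub>0..L\<^sub>1}. u x > 0 \<and> \<rho> x > 0) \<and>
     (\<forall>x\<in>{L\<^sub>0..L\<^sub>1}. \<rho> x * u x = \<rho>\<^sub>0 * u\<^sub>0) \<and>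
     (\<forall>x\<in>{L\<^sub>0..L\<^sub>1}. bernoulli \<gamma> (u x) (\<rho> x) - integral {L\<^sub>0..x} f = bernoulli \<gamma> u\<^sub>0 \<rho>\<^sub>0) \<and>
     u L\<^sub>0 = u\<^sub>0 \<and> \<rho> L\<^sub>0 = \<rho>\<^sub>0"

definition accelerating :: "real \<Rightarrow> real \<Rightarrow> (real \<Rightarrow> real) \<Rightarrow> bool" where
  "accelerating L\<^sub>0 L\<^sub>1 u \<longleftrightarrow> strict_mono_on {L\<^sub>0..L\<^sub>1} u"

definition accelerating_transonic_flow ::
  "real \<Rightarrow> real \<Rightarrow> real \<Rightarrow> real \<Rightarrow> real \<Rightarrow> (real \<Rightarrow> real) \<Rightarrow> (real \<Rightarrow> real) \<Rightarrow> (real \<Rightarrow> real) \<Rightarrow> bool" where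
  "accelerating_transonic_flow \<gamma> L\<^sub>0 L\<^sub>1 u\<^sub>0 \<rho>\<^sub>0 f u \<rho> \<longleftrightarrow>
     flow \<gamma> L\<^sub>0 L\<^sub>1 u\<^sub>0 \<rho>\<^sub>0 f u \<rho> \<and> accelerating L\<^sub>0 L\<^sub>1 u \<and>
     (\<forall>x\<in>{L\<^sub>0..<0}. subsonic \<gamma> (u x) (\<rho> x)) \<and>
     sonic \<gamma> (u 0) (\<rho> 0) \<and>
     (\<forall>x\<in>{0<..L\<^sub>1}. supersonic \<gamma> (u x) (\<rho> x))"

(* Classical solution of the steady Euler system with force f on S; derivatives are within S. *)
definition steady_euler_on ::
  "real set \<Rightarrow> real \<Rightarrow> (real \<Rightarrow> real) \<Rightarrow> (real \<Rightarrow> real) \<Rightarrow> (real \<Rightarrow> real) \<Rightarrow> bool" where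
  "steady_euler_on S \<gamma> f u \<rho> \<longleftrightarrow>
     (\<forall>x\<in>S.
        ((\<lambda>y. \<rho> y * u y) has_real_derivative 0) (at x within S) \<and>
        (\<exists>u' p'. (u has_real_derivative u') (at x within S) \<and>
           ((\<lambda>y. pressure \<gamma> (\<rho> y)) has_real_derivative p') (at x within S) \<and>
           \<rho> x * u x * u' + p' = \<rho> x * f x))"

end

(* Eliminating rho = J / u, the Bernoulli law reads h(u(x)) = E(x), where
   h(u) = u^2/2 + gamma/(gamma-1) (J/u)^(gamma-1) decreases up to the sonic velocity and increases
   beyond it, E = B0 + (integral of f from L0) decreases up to 0 and increases beyond it, and the
   integral condition says precisely that the two minima agree.  Flipping the sign of h - min h and
   of E - min E on the decreasing branches gives strictly increasing functions H and Phi, and the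
   transonic flows are exactly the solutions of H(u(x)) = Phi(x), so u is the composition of the
   inverse of H with Phi.  Away from 0 the derivative of u is f / h'(u), hence the algebra generated
   by the derivatives of f, the powers of u and 1 / h'(u) is closed under differentiation, and its
   elements, among them u and rho, are smooth. *)
theory Submission
  imports Defs
begin

section \<open>Turning a valley-shaped function into a strictly increasing one\<close>

text \<open>Equals \<open>h x - h c\<close> to the right of \<open>c\<close> and
  \<open>h c - h x\<close> to the left. Writing it with \<open>max\<close> and \<open>min\<close>
  avoids a case split, so continuity at \<open>c\<close> comes from composition.\<close>

definition unfold_at :: "real \<Rightarrow> (real \<Rightarrow> real) \<Rightarrow> real \<Rightarrow> real" where
  "unfold_at c h x = h (max x c) - h (min x c)"

lemma continuous_on_unfold_at:
  assumes "continuous_on A h" and "c \<in> A"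
  shows "continuous_on A (unfold_at c h)"
  unfolding unfold_at_def [abs_def]
proof (intro continuous_on_diff)
  have *: "max x c \<in> A" "min x c \<in> A" if "x \<in> A" for x
    using that assms(2) by (auto simp: max_def min_def)
  show "continuous_on A (\<lambda>x. h (max x c))" "continuous_on A (\<lambda>x. h (min x c))"
    using * by (auto intro!: continuous_on_compose2[OF assms(1)] continuous_intros)
qed

text \<open>The sign of the derivative makes \<open>h\<close> strictly decreasing before
  \<open>c\<close> and strictly increasing after it; flipping the sign on the first branch makes
  both increase.\<close>

lemma strict_mono_on_unfold_at:
  assumes conv: "\<And>a b. a \<in> A \<Longrightarrow> b \<in> A \<Longrightarrow> {a..b} \<subseteq> A"
    and c: "c \<in> A" and cont: "continuous_on A h"
    and deriv: "\<And>x. x \<in> interior A \<Longrightarrow> (h has_real_derivative h' x) (at x)"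
    and neg: "\<And>x. x \<in> A \<Longrightarrow> x < c \<Longrightarrow> h' x < 0"
    and pos: "\<And>x. x \<in> A \<Longrightarrow> x > c \<Longrightarrow> h' x > 0"
  shows "strict_mono_on A (unfold_at c h)"
proof (rule strict_mono_onI)
  \<comment> \<open>Points strictly between two points of \<open>A\<close> are interior, so the
    derivative is available there even when \<open>A\<close> contains its endpoints.\<close>
  have int: "x \<in> interior A" if "a \<in> A" "b \<in> A" "a < x" "x < b" for a b x
    using that conv[OF that(1,2)] by (intro interiorI[of "{a<..<b}"]) auto
  have dec: "h b < h a" if "a \<in> A" "b \<in> A" "a < b" "b \<le> c" for a b
  proof (rule DERIV_neg_imp_decreasing_open[OF \<open>a < b\<close>])
    show "continuous_on {a..b} h" using conv that cont by (metis continuous_on_subset)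
    show "\<exists>y. DERIV h x :> y \<and> y < 0" if "a < x" "x < b" for x
      using deriv[OF int[of a b x]] neg[of x] interior_subset[of A] int[of a b x] that
        \<open>a \<in> A\<close> \<open>b \<in> A\<close> \<open>b \<le> c\<close> by (intro exI[of _ "h' x"]) auto
  qed
  have inc: "h a < h b" if "a \<in> A" "b \<in> A" "a < b" "c \<le> a" for a b
  proof (rule DERIV_pos_imp_increasing_open[OF \<open>a < b\<close>])
    show "continuous_on {a..b} h" using conv that cont by (metis continuous_on_subset)
    show "\<exists>y. DERIV h x :> y \<and> y > 0" if "a < x" "x < b" for x
      using deriv[OF int[of a b x]] pos[of x] interior_subset[of A] int[of a b x] that
        \<open>a \<in> A\<close> \<open>b \<in> A\<close> \<open>c \<le> a\<close> by (intro exI[of _ "h' x"]) auto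
  qed
  fix x y assume "x \<in> A" "y \<in> A" "x < y"
  \<comment> \<open>When \<open>x < c < y\<close>, the left value is negative and the right value
    positive; otherwise both points lie on one branch.\<close>
  then show "unfold_at c h x < unfold_at c h y"
    using c dec[of x y] inc[of x y] dec[of x c] inc[of c y]
    by (cases "y \<le> c"; cases x c rule: linorder_cases) (auto simp: unfold_at_def max_def min_def)
qed

section \<open>Implicit differentiation\<close>

text \<open>Caratheodory's slope function \<open>q\<close> of \<phi> is nonzero near
  \<open>u x\<close>. Dividing the difference quotient of the composition by \<open>q (u y)\<close>,
  and not by \<open>u y - u x\<close>, leaves the quotient of \<open>u\<close> even where
  \<open>u y = u x\<close>.\<close>

lemma has_real_derivative_implicit:
  fixes u \<phi> :: "real \<Rightarrow> real"
  assumes outer: "(\<phi> has_real_derivative d) (at (u x))" and "d \<noteq> 0"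
    and comp: "((\<lambda>y. \<phi> (u y)) has_real_derivative e) (at x within S)"
    and cont: "continuous (at x within S) u"
  shows "(u has_real_derivative e / d) (at x within S)"
proof -
  obtain q where q: "\<And>z. \<phi> z - \<phi> (u x) = q z * (z - u x)" "isCont q (u x)" "q (u x) = d"
    using outer unfolding CARAT_DERIV by blast
  have qu: "((\<lambda>y. q (u y)) \<longlongrightarrow> d) (at x within S)"
    using q(2,3) cont isCont_tendsto_compose unfolding continuous_within by metis
  have "((\<lambda>y. (\<phi> (u y) - \<phi> (u x)) / (y - x) / q (u y)) \<longlongrightarrow> e / d) (at x within S)"
    using comp qu \<open>d \<noteq> 0\<close> by (intro tendsto_divide) (auto simp: has_field_derivative_iff)
  moreover have "\<forall>\<^sub>F y in at x within S. q (u y) \<noteq> 0"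
    using tendsto_imp_eventually_ne[OF qu \<open>d \<noteq> 0\<close>] .
  then have "\<forall>\<^sub>F y in at x within S.
      (\<phi> (u y) - \<phi> (u x)) / (y - x) / q (u y) = (u y - u x) / (y - x)"
    by eventually_elim (simp add: q(1))
  ultimately show ?thesis
    unfolding has_field_derivative_iff by (rule Lim_transform_eventually)
qed

section \<open>Smoothness through algebras closed under differentiation\<close>

text \<open>The unital real algebra of functions generated by \<open>G\<close>, with pointwise
  operations.\<close>

inductive_set function_algebra :: "(real \<Rightarrow> real) set \<Rightarrow> (real \<Rightarrow> real) set"
  for G :: "(real \<Rightarrow> real) set" where
  generator: "g \<in> G \<Longrightarrow> g \<in> function_algebra G"
| const: "(\<lambda>x. c) \<in> function_algebra G"
| add: "g \<in> function_algebra G \<Longrightarrow> h \<in> function_algebra G \<Longrightarrow> (\<lambda>x. g x + h x) \<in> function_algebra G"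
| mult: "g \<in> function_algebra G \<Longrightarrow> h \<in> function_algebra G \<Longrightarrow> (\<lambda>x. g x * h x) \<in> function_algebra G"

text \<open>The sum and product rules carry closure under differentiation from the generators to the
  whole algebra, and a derivative can then be taken repeatedly.\<close>

lemma smooth_on_function_algebra:
  assumes gen: "\<And>g. g \<in> G \<Longrightarrow>
      \<exists>g'\<in>function_algebra G. \<forall>x\<in>S. (g has_real_derivative g' x) (at x within S)"
    and g: "g \<in> function_algebra G"
  shows "smooth_on S g"
proof -
  have "\<exists>k'\<in>function_algebra G. \<forall>x\<in>S. (k has_real_derivative k' x) (at x within S)"
    if "k \<in> function_algebra G" for k
    using that
  proof induction
    case (generator g)
    then show ?case by (rule gen)
  next
    case (const c)
    show ?case by (rule bexI[of _ "\<lambda>x. 0"]) (auto intro: function_algebra.const)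
  next
    case (add g h)
    then obtain g' h' where "g' \<in> function_algebra G" "h' \<in> function_algebra G"
      "\<forall>x\<in>S. (g has_real_derivative g' x) (at x within S)"
      "\<forall>x\<in>S. (h has_real_derivative h' x) (at x within S)" by blast
    then show ?case
      by (intro bexI[of _ "\<lambda>x. g' x + h' x"])
        (auto intro!: function_algebra.add derivative_intros)
  next
    case (mult g h)
    then obtain g' h' where "g' \<in> function_algebra G" "h' \<in> function_algebra G"
      "\<forall>x\<in>S. (g has_real_derivative g' x) (at x within S)"
      "\<forall>x\<in>S. (h has_real_derivative h' x) (at x within S)" by blast
    with mult show ?case
      by (intro bexI[of _ "\<lambda>x. g' x * h x + h' x * g x"])
        (auto intro!: function_algebra.add function_algebra.mult DERIV_mult)
  qed
  \<comment> \<open>A choice of derivative for every member gives an operator \<open>d\<close>; its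
    iterates on \<open>g\<close> are the sequence that \<open>smooth_on\<close> asks for.\<close>
  then obtain d where d: "\<And>k. k \<in> function_algebra G \<Longrightarrow> d k \<in> function_algebra G"
      "\<And>k x. k \<in> function_algebra G \<Longrightarrow> x \<in> S \<Longrightarrow> (k has_real_derivative d k x) (at x within S)"
    by metis
  have "(d ^^ n) g \<in> function_algebra G" for n
    by (induction n) (auto simp: g d(1))
  then show ?thesis
    unfolding smooth_on_def by (intro exI[of _ "\<lambda>n. (d ^^ n) g"]) (auto intro: d(2))
qed

lemma smooth_on_cong: "smooth_on S g \<Longrightarrow> (\<And>x. x \<in> S \<Longrightarrow> g x = h x) \<Longrightarrow> smooth_on S h"
  unfolding smooth_on_def by (elim exE, rule exI) auto

lemma smooth_on_subset: "smooth_on T g \<Longrightarrow> S \<subseteq> T \<Longrightarrow> smooth_on S g"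
  unfolding smooth_on_def
proof (elim exE conjE, intro exI conjI ballI allI)
  fix D k x assume "S \<subseteq> T" "x \<in> S"
    and D: "\<forall>x\<in>T. D 0 x = g x"
      "\<forall>k. \<forall>x\<in>T. (D k has_real_derivative D (Suc k) x) (at x within T)"
  then show "D 0 x = g x" by blast
  show "(D k has_real_derivative D (Suc k) x) (at x within S)"
    using D(2) \<open>x \<in> S\<close> \<open>S \<subseteq> T\<close> by (intro DERIV_subset[OF _ \<open>S \<subseteq> T\<close>]) blast
qed

section \<open>The Bernoulli function at fixed mass flux\<close>

text \<open>The positive root of \<open>u^2 = c^2(J / u)\<close>, that is, of
  \<open>u^(\<gamma>+1) = \<gamma> J^(\<gamma>-1)\<close>.\<close>

definition sonic_velocity :: "real \<Rightarrow> real \<Rightarrow> real" where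
  "sonic_velocity \<gamma> J = (\<gamma> * J powr (\<gamma> - 1)) powr (1 / (\<gamma> + 1))"

locale mass_flux =
  fixes \<gamma> J :: real
  assumes gamma_gt_1: "\<gamma> > 1" and J_pos: "J > 0"
begin

abbreviation "u\<^sub>s \<equiv> sonic_velocity \<gamma> J"
abbreviation "h \<equiv> \<lambda>u. bernoulli \<gamma> u (J / u)"
abbreviation "h' \<equiv> \<lambda>u. u - u\<^sub>s powr (\<gamma> + 1) * u powr (- \<gamma>)"

lemma sonic_velocity_pos: "u\<^sub>s > 0"
  using gamma_gt_1 J_pos by (simp add: sonic_velocity_def)

lemma sonic_velocity_powr: "u\<^sub>s powr (\<gamma> + 1) = \<gamma> * J powr (\<gamma> - 1)"
  using gamma_gt_1 J_pos by (simp add: sonic_velocity_def powr_powr)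

text \<open>Together with \<open>square_eq_powr\<close> this puts the common factor
  \<open>u powr (1 - \<gamma>)\<close> into both \<open>u^2\<close> and \<open>c^2\<close>.
  Cancelling it reduces the flow regimes to comparing \<open>(\<gamma> + 1)\<close>-th powers of
  \<open>u\<close> and \<open>u\<^sub>s\<close>.\<close>

lemma sound_speed_square:
  assumes "u > 0"
  shows "(sound_speed \<gamma> (J / u))\<^sup>2 = u\<^sub>s powr (\<gamma> + 1) * u powr (1 - \<gamma>)"
proof -
  have "(sound_speed \<gamma> (J / u))\<^sup>2 = \<gamma> * (J / u) powr (\<gamma> - 1)"
    using gamma_gt_1 by (simp add: sound_speed_def)
  also have "(J / u) powr (\<gamma> - 1) = J powr (\<gamma> - 1) * u powr (1 - \<gamma>)"
    using assms J_pos powr_minus_divide[of u "\<gamma> - 1"] by (simp add: powr_divide)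
  finally show ?thesis by (simp add: sonic_velocity_powr)
qed

lemma square_eq_powr: "u > 0 \<Longrightarrow> u\<^sup>2 = u powr (\<gamma> + 1) * u powr (1 - \<gamma>)" for u :: real
  by (simp flip: powr_add)

lemma sonic_velocity_powr_less_iff:
  assumes "u > 0"
  shows "u powr (\<gamma> + 1) < u\<^sub>s powr (\<gamma> + 1) \<longleftrightarrow> u < u\<^sub>s"
    and "u\<^sub>s powr (\<gamma> + 1) < u powr (\<gamma> + 1) \<longleftrightarrow> u\<^sub>s < u"
  using powr_less_mono2[of "\<gamma> + 1" u "u\<^sub>s"] powr_less_mono2[of "\<gamma> + 1" "u\<^sub>s" u]
    assms gamma_gt_1 sonic_velocity_pos by (cases u "u\<^sub>s" rule: linorder_cases; auto)+

lemma subsonic_iff: "u > 0 \<Longrightarrow> subsonic \<gamma> u (J / u) \<longleftrightarrow> u < u\<^sub>s"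
  using gamma_gt_1 J_pos sonic_velocity_pos
  by (simp add: subsonic_def sound_speed_square square_eq_powr sonic_velocity_powr_less_iff)

lemma supersonic_iff: "u > 0 \<Longrightarrow> supersonic \<gamma> u (J / u) \<longleftrightarrow> u\<^sub>s < u"
  using gamma_gt_1 J_pos sonic_velocity_pos
  by (simp add: supersonic_def sound_speed_square square_eq_powr sonic_velocity_powr_less_iff)

lemma sonic_iff: "u > 0 \<Longrightarrow> sonic \<gamma> u (J / u) \<longleftrightarrow> u = u\<^sub>s"
  using subsonic_iff[of u] supersonic_iff[of u] J_pos
  by (auto simp: sonic_def subsonic_def supersonic_def)

text \<open>The enthalpy term of the Bernoulli law is \<open>c^2 / (\<gamma> - 1)\<close>, which
  gives a closed form in \<open>u\<close> that is easy to differentiate.\<close>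

lemma bernoulli_eq: 
  assumes "u > 0"
  shows "h u = u\<^sup>2 / 2 + u\<^sub>s powr (\<gamma> + 1) / (\<gamma> - 1) * u powr (1 - \<gamma>)"
  using sound_speed_square[OF assms] gamma_gt_1
  by (simp add: bernoulli_def sound_speed_def)

text \<open>The right-hand side is the constant in the integral hypothesis of the theorem. At the
  sonic velocity \<open>c^2 = u^2\<close>, so both Bernoulli terms are multiples of
  \<open>u\<^sub>s^2\<close>.\<close>

lemma bernoulli_sonic_velocity:
  "h u\<^sub>s = (\<gamma> + 1) / (2 * (\<gamma> - 1)) * \<gamma> powr (2 / (\<gamma> + 1)) * J powr (2 * (\<gamma> - 1) / (\<gamma> + 1))"
proof -
  have "u\<^sub>s\<^sup>2 = \<gamma> powr (2 / (\<gamma> + 1)) * J powr (2 * (\<gamma> - 1) / (\<gamma> + 1))"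
    using gamma_gt_1 J_pos
    by (simp add: sonic_velocity_def powr_mult powr_powr power_mult_distrib mult.commute
        flip: powr_numeral)
  moreover have "h u\<^sub>s = u\<^sub>s\<^sup>2 / 2 + u\<^sub>s\<^sup>2 / (\<gamma> - 1)"
    using sonic_velocity_pos by (simp add: bernoulli_eq square_eq_powr)
  moreover have "\<dots> = (\<gamma> + 1) / (2 * (\<gamma> - 1)) * u\<^sub>s\<^sup>2"
    using gamma_gt_1 by (simp add: field_simps)
  ultimately show ?thesis by simp
qed

lemma DERIV_bernoulli:
  assumes "u > 0"
  shows "(h has_real_derivative h' u) (at u)"
proof -
  have "((\<lambda>u. u\<^sup>2 / 2 + u\<^sub>s powr (\<gamma> + 1) / (\<gamma> - 1) * u powr (1 - \<gamma>)) has_real_derivative h' u) (at u)"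
  proof (rule DERIV_cong)
    show "((\<lambda>u. u\<^sup>2 / 2 + u\<^sub>s powr (\<gamma> + 1) / (\<gamma> - 1) * u powr (1 - \<gamma>))
        has_real_derivative u + u\<^sub>s powr (\<gamma> + 1) / (\<gamma> - 1) * ((1 - \<gamma>) * u powr (- \<gamma>))) (at u)"
      using assms gamma_gt_1 by (auto intro!: derivative_eq_intros)
    have "u\<^sub>s powr (\<gamma> + 1) / (\<gamma> - 1) * (1 - \<gamma>) = - (u\<^sub>s powr (\<gamma> + 1))"
      using gamma_gt_1 by (simp add: field_simps)
    then show "u + u\<^sub>s powr (\<gamma> + 1) / (\<gamma> - 1) * ((1 - \<gamma>) * u powr (- \<gamma>)) = h' u"
      by (simp only: mult.assoc[symmetric] mult_minus_left diff_conv_add_uminus)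
  qed
  note deriv = this
  \<comment> \<open>The closed form of \<open>h\<close> is available for positive velocities, so the
    derivative is transferred by equality near \<open>u\<close>.\<close>
  have "\<forall>\<^sub>F v in nhds u. 0 < v"
    using assms by (simp add: eventually_nhds_in_open[of "{0<..}", simplified])
  then have ev: "\<forall>\<^sub>F v in nhds u. v\<^sup>2 / 2 + u\<^sub>s powr (\<gamma> + 1) / (\<gamma> - 1) * v powr (1 - \<gamma>) = h v"
    by eventually_elim (simp add: bernoulli_eq)
  show ?thesis
    using deriv by (rule iffD1[OF DERIV_cong_ev[OF refl ev refl]])
qed

text \<open>Exhibits the sign of \<open>h'\<close>: negative below the sonic velocity, positive
  above it.\<close>

lemma DERIV_bernoulli_factor: "u > 0 \<Longrightarrow> h' u = u powr (- \<gamma>) * (u powr (\<gamma> + 1) - u\<^sub>s powr (\<gamma> + 1))"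
  by (simp add: algebra_simps flip: powr_add)

lemma continuous_on_bernoulli: "continuous_on {0<..} h"
  by (metis DERIV_bernoulli DERIV_isCont continuous_at_imp_continuous_on greaterThan_iff)

lemma strict_mono_on_unfold_bernoulli: "strict_mono_on {0<..} (unfold_at u\<^sub>s h)"
proof (rule strict_mono_on_unfold_at[where h' = h'])
  show "h' x < 0" if "x \<in> {0<..}" "x < u\<^sub>s" for x
    using that gamma_gt_1 sonic_velocity_pos
    by (subst DERIV_bernoulli_factor) (auto simp: mult_pos_neg sonic_velocity_powr_less_iff)
  show "h' x > 0" if "x \<in> {0<..}" "x > u\<^sub>s" for x
    using that gamma_gt_1 sonic_velocity_pos
    by (subst DERIV_bernoulli_factor) (auto simp: sonic_velocity_powr_less_iff)
qed (auto simp: sonic_velocity_pos continuous_on_bernoulli DERIV_bernoulli interior_open)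

lemma exists_unfold_bernoulli_ge: "\<exists>v\<ge>u\<^sub>s. unfold_at u\<^sub>s h v \<ge> K"
proof (intro exI conjI)
  \<comment> \<open>The square root makes \<open>?v^2 / 2\<close>, and hence \<open>h ?v\<close>, at
    least \<open>K + h u\<^sub>s\<close>; the maximum keeps \<open>?v\<close> on the increasing
    branch.\<close>
  let ?v = "max u\<^sub>s (sqrt (2 * \<bar>K + h u\<^sub>s\<bar>))"
  show "?v \<ge> u\<^sub>s" by simp
  then have pos: "?v > 0" using sonic_velocity_pos by linarith
  have "(sqrt (2 * \<bar>K + h u\<^sub>s\<bar>))\<^sup>2 \<le> ?v\<^sup>2" by (rule power_mono) auto
  moreover have "?v\<^sup>2 / 2 \<le> h ?v"
    using gamma_gt_1 by (simp add: bernoulli_eq[OF pos])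
  ultimately have "K + h u\<^sub>s \<le> h ?v"
    using abs_ge_self[of "K + h u\<^sub>s"]
    unfolding real_sqrt_pow2[OF mult_nonneg_nonneg[OF zero_le_numeral abs_ge_zero]] by linarith
  then show "unfold_at u\<^sub>s h ?v \<ge> K"
    using \<open>?v \<ge> u\<^sub>s\<close> unfolding unfold_at_def by (simp only: max_absorb1 min_absorb2)
qed

lemma DERIV_bernoulli_nonzero: "u > 0 \<Longrightarrow> u \<noteq> u\<^sub>s \<Longrightarrow> h' u \<noteq> 0"
  using sonic_velocity_powr_less_iff[of u]
  by (subst DERIV_bernoulli_factor) (auto simp: neq_iff)

section \<open>Smoothness and the Euler equations away from the sonic point\<close>

lemma smooth_on_flow:
  assumes f: "smooth_on S f" and pos: "\<And>x. x \<in> S \<Longrightarrow> u x > 0"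
    and not_sonic: "\<And>x. x \<in> S \<Longrightarrow> u x \<noteq> u\<^sub>s"
    and u: "\<And>x. x \<in> S \<Longrightarrow> (u has_real_derivative f x / h' (u x)) (at x within S)"
  shows "smooth_on S u" and "smooth_on S (\<lambda>x. J / u x)"
proof -
  obtain D where D: "\<And>x. x \<in> S \<Longrightarrow> D 0 x = f x"
    "\<And>k x. x \<in> S \<Longrightarrow> (D k has_real_derivative D (Suc k) x) (at x within S)"
    using f unfolding smooth_on_def by blast
  \<comment> \<open>All real powers of \<open>u\<close> are included because differentiation lowers
    the exponent by one.\<close>
  define G where
    "G = range D \<union> range (\<lambda>a x. u x powr a) \<union> {\<lambda>x. inverse (h' (u x))}"
  have gens: "D k \<in> function_algebra G" "(\<lambda>x. u x powr a) \<in> function_algebra G"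
    "(\<lambda>x. inverse (h' (u x))) \<in> function_algebra G" for k a
    by (auto simp: G_def intro!: function_algebra.generator)
  \<comment> \<open>\<open>D 0\<close> stands in for \<open>f\<close>, with which it agrees on
    \<open>S\<close>, because it is a generator.\<close>
  define u' where "u' = (\<lambda>x. D 0 x * inverse (h' (u x)))"
  have u'_mem: "u' \<in> function_algebra G"
    unfolding u'_def by (intro function_algebra.mult gens)
  have u': "(u has_real_derivative u' x) (at x within S)" if "x \<in> S" for x
    using u[OF that] by (simp add: u'_def D(1)[OF that] divide_inverse)
  have smooth: "smooth_on S g" if "g \<in> function_algebra G" for g
  proof (rule smooth_on_function_algebra[OF _ that])
    fix g assume "g \<in> G"
    then consider k where "g = D k" | a where "g = (\<lambda>x. u x powr a)" | "g = (\<lambda>x. inverse (h' (u x)))"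
      by (auto simp: G_def)
    then show "\<exists>g'\<in>function_algebra G. \<forall>x\<in>S. (g has_real_derivative g' x) (at x within S)"
    proof cases
      case 1
      then show ?thesis using D(2) gens(1) by blast
    next
      case 2
      show ?thesis
      proof (intro bexI ballI)
        show "(\<lambda>x. a * (u x powr (a - 1) * u' x)) \<in> function_algebra G"
          by (intro function_algebra.const function_algebra.mult gens u'_mem)
        show "(g has_real_derivative a * (u x powr (a - 1) * u' x)) (at x within S)"
          if "x \<in> S" for x
          unfolding 2 by (rule derivative_eq_intros u'[OF that] pos[OF that] refl)+ simp
      qed
    next
      case 3
      show ?thesis
      proof (intro bexI ballI)
        \<comment> \<open>The chain rule for \<open>h' (u x)\<close>. It and the derivative of the
          reciprocal are written with constants, sums and products alone, whence the factor
          \<open>-1\<close>.\<close>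
        let ?d = "\<lambda>x. (1 + (u\<^sub>s powr (\<gamma> + 1) * \<gamma>) * u x powr (- \<gamma> - 1)) * u' x"
        let ?i = "\<lambda>x. inverse (h' (u x))"
        show "(\<lambda>x. (-1) * (?d x * (?i x * ?i x))) \<in> function_algebra G"
          by (intro function_algebra.const function_algebra.add function_algebra.mult gens u'_mem)
        show "(g has_real_derivative (-1) * (?d x * (?i x * ?i x))) (at x within S)"
          if "x \<in> S" for x
        proof -
          have "((\<lambda>x. h' (u x)) has_real_derivative ?d x) (at x within S)"
            by (rule derivative_eq_intros u'[OF that] pos[OF that] refl)+ (simp add: algebra_simps)
          then show ?thesis
            unfolding 3 using DERIV_bernoulli_nonzero[OF pos[OF that] not_sonic[OF that]]
            by (auto dest: DERIV_inverse' simp: mult_ac)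
        qed
      qed
    qed
  qed
  \<comment> \<open>As \<open>u\<close> is positive on \<open>S\<close>, there
    \<open>u = u powr 1\<close> and \<open>J / u = J * u powr (-1)\<close>, both in the
    algebra.\<close>
  show "smooth_on S u"
    using smooth[OF gens(2)[of 1]] by (rule smooth_on_cong) (use pos in \<open>auto simp: less_imp_le\<close>)
  show "smooth_on S (\<lambda>x. J / u x)"
    using smooth[OF function_algebra.mult[OF function_algebra.const gens(2)[of "-1"]], of J]
    by (rule smooth_on_cong) (use pos in \<open>auto simp: powr_minus divide_inverse less_imp_le\<close>)
qed

text \<open>With \<open>\<rho> = J / u\<close>, the left side of the momentum equation factors as
  \<open>\<rho> u' (u - c^2 / u)\<close>. The bracket is \<open>h' u\<close>, and
  \<open>u' h' u = f\<close>.\<close>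

lemma steady_euler_on_flow:
  assumes pos: "\<And>x. x \<in> S \<Longrightarrow> u x > 0"
    and not_sonic: "\<And>x. x \<in> S \<Longrightarrow> u x \<noteq> u\<^sub>s"
    and u: "\<And>x. x \<in> S \<Longrightarrow> (u has_real_derivative f x / h' (u x)) (at x within S)"
  shows "steady_euler_on S \<gamma> f u (\<lambda>x. J / u x)"
  unfolding steady_euler_on_def
proof (intro ballI conjI exI)
  fix x assume x: "x \<in> S"
  let ?u' = "f x / h' (u x)"
  let ?p' = "- (\<gamma> * (J / u x) powr (\<gamma> - 1) * (J / (u x)\<^sup>2) * ?u')"
  show "((\<lambda>y. J / u y * u y) has_real_derivative 0) (at x within S)"
    \<comment> \<open>The product equals the constant \<open>J\<close> on all of \<open>S\<close>,
      so radius one serves as well as any other.\<close>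
    by (rule has_field_derivative_transform_within[OF DERIV_const[of J] zero_less_one x])
      (use pos in force)
  show "(u has_real_derivative ?u') (at x within S)" by (rule u[OF x])
  show "((\<lambda>y. pressure \<gamma> (J / u y)) has_real_derivative ?p') (at x within S)"
    unfolding pressure_def using pos[OF x] J_pos
    by (auto intro!: derivative_eq_intros u[OF x] simp: power2_eq_square mult_ac)
  \<comment> \<open>This is \<open>c^2 / u\<close>, the subtracted term of
    \<open>h'\<close>.\<close>
  have "\<gamma> * (J / u x) powr (\<gamma> - 1) / u x = u\<^sub>s powr (\<gamma> + 1) * u x powr (- \<gamma>)"
    using sound_speed_square[OF pos[OF x]] pos[OF x] gamma_gt_1 powr_diff[of "u x" "1 - \<gamma>" 1]
    by (simp add: sound_speed_def)
  moreover have "J / v * v * a + - (c * (J / v\<^sup>2) * a) = J / v * (a * (v - w))"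
    if "c / v = w" "v > 0" for a c v w :: real
    using that by (auto simp: power2_eq_square algebra_simps)
  ultimately have "J / u x * u x * ?u' + ?p' =
      J / u x * (?u' * h' (u x))"
    using pos[OF x] by blast
  also have "?u' * h' (u x) = f x"
    using DERIV_bernoulli_nonzero[OF pos[OF x] not_sonic[OF x]] by simp
  finally show "J / u x * u x * ?u' + ?p' = J / u x * f x" .
qed

end

section \<open>Existence, uniqueness and regularity of the transonic flow\<close>

theorem proposition1p1:
  fixes \<gamma> L\<^sub>0 L\<^sub>1 u\<^sub>0 \<rho>\<^sub>0 J B\<^sub>0 :: real and f :: "real \<Rightarrow> real"
  assumes "\<gamma> > 1" and "L\<^sub>0 < 0" and "0 < L\<^sub>1" and "\<rho>\<^sub>0 > 0" and "u\<^sub>0 > 0"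
    and "J = \<rho>\<^sub>0 * u\<^sub>0" and "B\<^sub>0 = bernoulli \<gamma> u\<^sub>0 \<rho>\<^sub>0"
    and "subsonic \<gamma> u\<^sub>0 \<rho>\<^sub>0"
    and "smooth_on {L\<^sub>0..L\<^sub>1} f"
    and "\<forall>x\<in>{L\<^sub>0..<0}. f x < 0" and "f 0 = 0" and "\<forall>x\<in>{0<..L\<^sub>1}. f x > 0"
    and "integral {L\<^sub>0..0} f =
      (\<gamma> + 1) / (2 * (\<gamma> - 1)) * \<gamma> powr (2 / (\<gamma> + 1)) * J powr (2 * (\<gamma> - 1) / (\<gamma> + 1)) - B\<^sub>0"
  shows "\<exists>u \<rho> :: real \<Rightarrow> real.
    accelerating_transonic_flow \<gamma> L\<^sub>0 L\<^sub>1 u\<^sub>0 \<rho>\<^sub>0 f u \<rho> \<and>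
    (\<forall>v \<sigma>. accelerating_transonic_flow \<gamma> L\<^sub>0 L\<^sub>1 u\<^sub>0 \<rho>\<^sub>0 f v \<sigma> \<longrightarrow>
      (\<forall>x\<in>{L\<^sub>0..L\<^sub>1}. v x = u x \<and> \<sigma> x = \<rho> x)) \<and>
    smooth_on ({L\<^sub>0..<0} \<union> {0<..L\<^sub>1}) u \<and> smooth_on ({L\<^sub>0..<0} \<union> {0<..L\<^sub>1}) \<rho> \<and>
    steady_euler_on ({L\<^sub>0..<0} \<union> {0<..L\<^sub>1}) \<gamma> f u \<rho> \<and>
    \<rho> L\<^sub>0 = \<rho>\<^sub>0 \<and> u L\<^sub>0 = u\<^sub>0"
proof -
  interpret mass_flux \<gamma> J
    using assms by unfold_locales auto
  define I where "I = {L\<^sub>0..L\<^sub>1}"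
  define S where "S = {L\<^sub>0..<0} \<union> {0<..L\<^sub>1}"
  define E where "E = (\<lambda>x. B\<^sub>0 + integral {L\<^sub>0..x} f)"
  define H where "H = unfold_at u\<^sub>s h"
  define \<Phi> where "\<Phi> = unfold_at 0 E"
  have I: "L\<^sub>0 \<in> I" "L\<^sub>1 \<in> I" "0 \<in> I" "S \<subseteq> I" "x \<in> S \<longleftrightarrow> x \<in> I \<and> x \<noteq> 0" for x
    using assms(2,3) by (auto simp: I_def S_def)
  have \<rho>\<^sub>0: "\<rho>\<^sub>0 = J / u\<^sub>0" using assms(5,6) by simp
  have u\<^sub>0_less: "u\<^sub>0 < u\<^sub>s"
    using assms(5,8) subsonic_iff by (simp add: \<rho>\<^sub>0)
  have E0: "E 0 = h u\<^sub>s" using assms(13) by (simp add: E_def bernoulli_sonic_velocity)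
  have EL0: "E L\<^sub>0 = h u\<^sub>0" using assms(7) \<rho>\<^sub>0 by (simp add: E_def)

  have contf: "continuous_on I f"
  proof -
    obtain D where D: "\<forall>x\<in>I. D 0 x = f x"
        "\<forall>k. \<forall>x\<in>I. (D k has_real_derivative D (Suc k) x) (at x within I)"
      using assms(9) unfolding smooth_on_def I_def by (elim exE conjE)
    have "continuous_on I (D 0)"
      by (rule DERIV_continuous_on) (use D(2) in blast)
    then show ?thesis by (rule continuous_on_eq) (use D(1) in blast)
  qed
  have DE: "(E has_real_derivative f x) (at x within I)" if "x \<in> I" for x
    using integral_has_real_derivative[of L\<^sub>0 L\<^sub>1 f x] contf that
    unfolding E_def I_def by (auto intro!: derivative_eq_intros)
  have contE: "continuous_on I E" using DE by (rule DERIV_continuous_on)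
  have cont\<Phi>: "continuous_on I \<Phi>"
    unfolding \<Phi>_def using contE I(3) by (rule continuous_on_unfold_at)
  have mono\<Phi>: "strict_mono_on I \<Phi>"
    unfolding \<Phi>_def
  proof (rule strict_mono_on_unfold_at[where h' = f])
    show "(E has_real_derivative f x) (at x)" if "x \<in> interior I" for x
      using DE[of x] that interior_subset[of I] at_within_interior[OF that] by auto
  qed (use assms(10,12) I contE in \<open>auto simp: I_def\<close>)
  have monoH: "strict_mono_on {0<..} H"
    unfolding H_def by (rule strict_mono_on_unfold_bernoulli)
  have contH: "continuous_on {0<..} H"
    unfolding H_def using continuous_on_bernoulli sonic_velocity_pos
    by (intro continuous_on_unfold_at) auto

  \<comment> \<open>\<open>H\<close> vanishes at \<open>u\<^sub>s\<close> and \<Phi> at 0, so equal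
    values have equal signs: the equation encodes the Bernoulli law and the choice of branch at
    once. Existence reads it from left to right, uniqueness from right to left.\<close>
  have key: "H v = \<Phi> x \<longleftrightarrow>
      h v = E x \<and> (x < 0 \<longrightarrow> v < u\<^sub>s) \<and> (x = 0 \<longrightarrow> v = u\<^sub>s) \<and> (0 < x \<longrightarrow> u\<^sub>s < v)"
    if "v > 0" "x \<in> I" for v x
  proof -
    have "H v < H u\<^sub>s \<longleftrightarrow> v < u\<^sub>s" "H u\<^sub>s < H v \<longleftrightarrow> u\<^sub>s < v" "H v = H u\<^sub>s \<longleftrightarrow> v = u\<^sub>s"
      using strict_mono_on_less[OF monoH, of v "u\<^sub>s"] strict_mono_on_less[OF monoH, of "u\<^sub>s" v]
        strict_mono_on_eq[OF monoH, of v "u\<^sub>s"] that sonic_velocity_pos by auto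
    moreover have "\<Phi> x < \<Phi> 0 \<longleftrightarrow> x < 0" "\<Phi> 0 < \<Phi> x \<longleftrightarrow> 0 < x"
      using strict_mono_on_less[OF mono\<Phi>] that I by auto
    moreover have "H u\<^sub>s = 0" "\<Phi> 0 = 0" by (auto simp: H_def \<Phi>_def unfold_at_def)
    moreover have "H v = (if v \<le> u\<^sub>s then h u\<^sub>s - h v else h v - h u\<^sub>s)"
      by (auto simp: H_def unfold_at_def)
    moreover have "\<Phi> x = (if x \<le> 0 then h u\<^sub>s - E x else E x - h u\<^sub>s)"
      by (auto simp: \<Phi>_def unfold_at_def E0)
    ultimately show ?thesis
      by (cases x "0::real" rule: linorder_cases; cases v "u\<^sub>s" rule: linorder_cases) (auto split: if_splits)
  qed

  \<comment> \<open>\<open>U\<close> bounds the velocity range from above: \<open>H\<close> maps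
    \<open>{u\<^sub>0..U}\<close> onto a set containing all values of \<Phi> on \<open>I\<close>, by
    the intermediate value theorem.\<close>
  obtain U where U: "U \<ge> u\<^sub>s" "H U \<ge> \<Phi> L\<^sub>1"
    using exists_unfold_bernoulli_ge[of "\<Phi> L\<^sub>1"] unfolding H_def by blast
  define K where "K = {u\<^sub>0..U}"
  have K: "K \<subseteq> {0<..}" "u\<^sub>0 \<in> K" using assms(5) U u\<^sub>0_less by (auto simp: K_def)
  have injH: "inj_on H K"
    using strict_mono_on_imp_inj_on[OF monoH] K(1) by (rule inj_on_subset)
  have contHK: "continuous_on K H" using contH K(1) by (rule continuous_on_subset)
  have start: "H u\<^sub>0 = \<Phi> L\<^sub>0" using key[of u\<^sub>0 L\<^sub>0] assms(2,5) EL0 I u\<^sub>0_less by simp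
  have range: "\<Phi> x \<in> H ` K" if "x \<in> I" for x
  proof -
    have "\<Phi> L\<^sub>0 \<le> \<Phi> x" "\<Phi> x \<le> \<Phi> L\<^sub>1"
      using strict_mono_on_leD[OF mono\<Phi>] that by (auto simp: I_def)
    then show ?thesis
      using IVT'[of H u\<^sub>0 "\<Phi> x" U] start U u\<^sub>0_less contHK by (force simp: K_def)
  qed
  define u where "u = (\<lambda>x. the_inv_into K H (\<Phi> x))"
  have Hu: "H (u x) = \<Phi> x" "u x > 0" if "x \<in> I" for x
    using f_the_inv_into_f[OF injH range[OF that]] the_inv_into_into[OF injH range[OF that] order_refl] K
    by (auto simp: u_def)
  \<comment> \<open>The inverse of the continuous injection \<open>H\<close> is continuous because
    \<open>K\<close> is compact.\<close>
  have contu: "continuous_on I u"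
    unfolding u_def
    using continuous_on_inv_into[OF contHK _ injH] range
    by (intro continuous_on_compose2[OF _ cont\<Phi>]) (auto simp: K_def)
  have monou: "strict_mono_on I u"
  proof (rule strict_mono_onI)
    fix x y assume "x \<in> I" "y \<in> I" "x < y"
    then show "u x < u y"
      using strict_mono_on_less[OF monoH, of "u x" "u y"] strict_mono_on_less[OF mono\<Phi>, of x y] Hu
      by auto
  qed
  have uL0: "u L\<^sub>0 = u\<^sub>0"
    unfolding u_def start[symmetric] using injH K(2) by (rule the_inv_into_f_f)
  have u_props: "h (u x) = E x" "x < 0 \<Longrightarrow> u x < u\<^sub>s" "x = 0 \<Longrightarrow> u x = u\<^sub>s" "0 < x \<Longrightarrow> u\<^sub>s < u x"
    if "x \<in> I" for x
    using key[OF Hu(2)[OF that] that] Hu(1)[OF that] by auto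

  define \<rho> where "\<rho> = (\<lambda>x. J / u x)"
  have transonic: "accelerating_transonic_flow \<gamma> L\<^sub>0 L\<^sub>1 u\<^sub>0 \<rho>\<^sub>0 f u \<rho>"
    unfolding accelerating_transonic_flow_def flow_def accelerating_def
  proof (intro conjI ballI; (fold I_def)?)
    show "continuous_on I \<rho>"
      unfolding \<rho>_def using Hu(2) by (intro continuous_intros contu) force
    show "bernoulli \<gamma> (u x) (\<rho> x) - integral {L\<^sub>0..x} f = bernoulli \<gamma> u\<^sub>0 \<rho>\<^sub>0" if "x \<in> I" for x
      using u_props(1)[OF that] assms(7) by (simp add: E_def \<rho>_def)
    show "subsonic \<gamma> (u x) (\<rho> x)" if "x \<in> {L\<^sub>0..<0}" for x
      using that u_props(2)[of x] Hu(2)[of x] assms(3) by (simp add: \<rho>_def subsonic_iff I_def)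
    show "sonic \<gamma> (u 0) (\<rho> 0)"
      using u_props(3)[of 0] Hu(2)[of 0] I by (simp add: \<rho>_def sonic_iff)
    show "supersonic \<gamma> (u x) (\<rho> x)" if "x \<in> {0<..L\<^sub>1}" for x
      using that u_props(4)[of x] Hu(2)[of x] assms(2) by (simp add: \<rho>_def supersonic_iff I_def)
    show "\<rho> L\<^sub>0 = \<rho>\<^sub>0" by (simp add: \<rho>_def uL0 \<rho>\<^sub>0)
    show "0 < \<rho> x" if "x \<in> I" for x
      using Hu(2)[OF that] J_pos by (simp add: \<rho>_def)
    show "\<rho> x * u x = \<rho>\<^sub>0 * u\<^sub>0" if "x \<in> I" for x
      using Hu(2)[OF that] assms(6) by (simp add: \<rho>_def)
  qed (use contu monou uL0 Hu in auto)

  \<comment> \<open>A competing velocity need not lie in \<open>K\<close> a priori, so the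
    comparison uses injectivity of \<open>H\<close> on all positive velocities.\<close>
  have unique: "v x = u x \<and> \<sigma> x = \<rho> x"
    if vs: "accelerating_transonic_flow \<gamma> L\<^sub>0 L\<^sub>1 u\<^sub>0 \<rho>\<^sub>0 f v \<sigma>" and x: "x \<in> {L\<^sub>0..L\<^sub>1}" for v \<sigma> x
  proof -
    have "flow \<gamma> L\<^sub>0 L\<^sub>1 u\<^sub>0 \<rho>\<^sub>0 f v \<sigma>" using vs by (simp add: accelerating_transonic_flow_def)
    then have flow: "v x > 0" "\<sigma> x * v x = J"
      "bernoulli \<gamma> (v x) (\<sigma> x) - integral {L\<^sub>0..x} f = B\<^sub>0"
      using x assms(6,7) by (auto simp: flow_def)
    have v: "v x > 0" "\<sigma> x = J / v x" "h (v x) = E x"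
    proof -
      show "\<sigma> x = J / v x" using flow(1,2) by (simp add: eq_divide_eq)
      with flow(3) show "h (v x) = E x" by (simp add: E_def)
    qed (rule flow(1))
    moreover have "x < 0 \<Longrightarrow> v x < u\<^sub>s" "x = 0 \<Longrightarrow> v x = u\<^sub>s" "0 < x \<Longrightarrow> u\<^sub>s < v x"
    proof -
      have "x < 0 \<Longrightarrow> subsonic \<gamma> (v x) (\<sigma> x)" "x = 0 \<Longrightarrow> sonic \<gamma> (v x) (\<sigma> x)"
        "0 < x \<Longrightarrow> supersonic \<gamma> (v x) (\<sigma> x)"
        using vs x unfolding accelerating_transonic_flow_def by auto
      then show "x < 0 \<Longrightarrow> v x < u\<^sub>s" "x = 0 \<Longrightarrow> v x = u\<^sub>s" "0 < x \<Longrightarrow> u\<^sub>s < v x"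
        unfolding v(2) using subsonic_iff[OF v(1)] sonic_iff[OF v(1)] supersonic_iff[OF v(1)] by blast+
    qed
    ultimately have "H (v x) = \<Phi> x"
      using key x by (simp add: I_def)
    then have "v x = u x"
      using strict_mono_on_eq[OF monoH, of "v x" "u x"] v(1) Hu x by (auto simp: I_def)
    then show ?thesis using v(2) by (simp add: \<rho>_def)
  qed

  have pos: "u x > 0" if "x \<in> S" for x using that I Hu(2) by auto
  have not_sonic: "u x \<noteq> u\<^sub>s" if "x \<in> S" for x
    using that I(5) u_props(2,4)[of x] by (cases x "0::real" rule: linorder_cases) auto
  \<comment> \<open>Implicit differentiation of \<open>h (u x) = E x\<close>, possible because
    \<open>h'\<close> vanishes only at the sonic velocity, which \<open>u\<close> avoids on
    \<open>S\<close>.\<close>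
  have deriv: "(u has_real_derivative f x / h' (u x)) (at x within S)" if x: "x \<in> S" for x
  proof (rule has_real_derivative_implicit)
    show "(h has_real_derivative h' (u x)) (at (u x))" by (rule DERIV_bernoulli[OF pos[OF x]])
    show "h' (u x) \<noteq> 0" by (rule DERIV_bernoulli_nonzero[OF pos[OF x] not_sonic[OF x]])
    have "(E has_real_derivative f x) (at x within S)"
      using DE I(4) by (rule DERIV_subset) (use x I(4) in blast)
    then show "((\<lambda>y. h (u y)) has_real_derivative f x) (at x within S)"
      by (rule has_field_derivative_transform_within[OF _ zero_less_one x])
        (use I(4) u_props(1) in auto)
    show "continuous (at x within S) u"
      using continuous_on_subset[OF contu I(4)] x by (simp add: continuous_on_eq_continuous_within)
  qed
  have smoothf: "smooth_on S f"
    using assms(9) I(4) smooth_on_subset by (auto simp: I_def)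
  show ?thesis
  proof (intro exI conjI allI impI ballI; (fold S_def)?)
    show "accelerating_transonic_flow \<gamma> L\<^sub>0 L\<^sub>1 u\<^sub>0 \<rho>\<^sub>0 f u \<rho>" by (rule transonic)
    show "v x = u x" "\<sigma> x = \<rho> x"
      if "accelerating_transonic_flow \<gamma> L\<^sub>0 L\<^sub>1 u\<^sub>0 \<rho>\<^sub>0 f v \<sigma>" "x \<in> {L\<^sub>0..L\<^sub>1}" for v \<sigma> x
      using unique[OF that] by blast+
    show "smooth_on S u"
      using smoothf pos not_sonic deriv by (rule smooth_on_flow(1))
    show "smooth_on S \<rho>"
      unfolding \<rho>_def using smoothf pos not_sonic deriv by (rule smooth_on_flow(2))
    show "steady_euler_on S \<gamma> f u \<rho>"
      unfolding \<rho>_def using pos not_sonic deriv by (rule steady_euler_on_flow)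
    show "\<rho> L\<^sub>0 = \<rho>\<^sub>0" by (simp add: \<rho>_def uL0 \<rho>\<^sub>0)
    show "u L\<^sub>0 = u\<^sub>0" by (rule uL0)
  qed
qed

end
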